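(* Let $F$ be a clause set. If $F$ is satisfiable, then the reasoning algorithm with inference rules $\mathrm{A1}^+$, $\mathrm{A2}^+$, and A3, started from $\mathcal{S}_0=\{F\}$, yields a complete and clash-free family of clause sets (i.e. some sequence of rule applications from $\mathcal{S}_0$ ends in a complete and clash-free family).
   Context: $\mathcal{ALC}$ interpretations $\mathcal{I}=(\Delta^\mathcal{I},\cdot^\mathcal{I})$ with the standard semantics of $\lnot,\sqcap,\sqcup,\forall R.,\exists R.$. Conjunctive normal forms are defined by mutual induction: a concept literal is $A$, $\lnot A$ ($A$ a concept name), $\exists R.F$ or $\forall R.F$ ($R$ a role name, $F$ a conjunctive normal form); a clause is a finite disjunction of concept literals, represented as a set of literals; a conjunctive normal form is a finite conjunction of clauses, represented as a clause set. A clause set denotes the conjunction of its clauses, each clause the disjunction of its literals; $F$ is satisfiable if $F^\mathcal{I}\neq\emptyset$ for some $\mathcal{I}$. The complementary literal $\overline{L}$ is: $\overline{A}=\lnot A$, $\overline{\lnot A}=A$, $\overline{\exists R.F}=\forall R.\mathrm{CNF}(\lnot F)$, $\overline{\forall R.F}=\exists R.\mathrm{CNF}(\lnot F)$, with $\mathrm{CNF}(C)$ the equivalent conjunctive normal form of $C$ (push negations inward, distribute $\sqcup$ over $\sqcap$, flatten). A derivation works on families of clause sets $\mathcal{S}_i$, starting with $\mathcal{S}_0=\{F\}$; $\mathcal{S}_{i+1}$ is obtained from $\mathcal{S}_i$ by applying one of the following rules to a clause set $F\in\mathcal{S}_i$: ($\mathrm{A1}^+$) if $L\in CL$ for a clause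 $CL\in F$ (nondeterministic choice of $L$): replace every clause $CL'\in F$ with $L\in CL'$ by $\{L\}$, and every clause $CL'\in F$ with $\overline{L}\in CL'$ by $CL'\setminus\{\overline{L}\}$. ($\mathrm{A2}^+$) if all clauses of $F$ are unit clauses and $\forall R.F_1\in CL$ for some $CL\in F$: remove from $F$ all clauses containing $\forall R.F_1$, and replace every literal $\exists R.F_2$ occurring in clauses of $F$ by $\exists R.(F_1\cup F_2)$. (A3) if all clauses of $F$ are unit clauses of the form $\{A\}$, $\{\lnot A\}$ or $\{\exists R.F'\}$: for some $\{\exists R.F_1\}\in F$, replace $F$ by $F\setminus\{\{\exists R.F_1\}\}$ and add $F_1$ to the family ($F$ is the parent of $F_1$ with respect to $R$). A family is complete if no rule is applicable to it. It is clash-free if no clause set in it contains the empty clause or contains both $\{L\}$ and $\{\overline{L}\}$ for some literal $L$.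
   Formalization: Rule A1+ counts as applicable only if it changes the clause set (and "complete" is meant accordingly); read literally, A1+ could be re-applied forever without effect, e.g. to F={{A}}, so that no complete family would be reachable. *)

theory Defs
  imports Main "HOL-Library.FSet"
begin

datatype ('c, 'r) literal =
    Pos 'c
  | Neg 'c
  | Ex 'r "('c, 'r) literal fset fset"
  | All 'r "('c, 'r) literal fset fset"

type_synonym ('c, 'r) clause = "('c, 'r) literal fset"
type_synonym ('c, 'r) clause_set = "('c, 'r) clause fset"

record ('c, 'r, 'd) interp =
  domain :: "'d set"
  conc :: "'c \<Rightarrow> 'd set"
  role :: "'r \<Rightarrow> ('d \<times> 'd) set"

definition is_interp :: "('c, 'r, 'd) interp \<Rightarrow> bool" where
  "is_interp I \<longleftrightarrow> domain I \<noteq> {} \<and> (\<forall>A. conc I A \<subseteq> domain I) \<and> (\<forall>R. role I R \<subseteq> domain I \<times> domain I)"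

lemma size_in_clause: "L |\<in>| CL \<Longrightarrow> size L < size_fset size CL"
  using sum.remove[of "fset CL" L "Suc \<circ> size"] by (simp add: size_fset_simps)

lemma size_in_clause_set: "CL |\<in>| F \<Longrightarrow> size_fset size CL < size_fset (size_fset size) F"
  using sum.remove[of "fset F" CL "Suc \<circ> size_fset size"] by (simp add: size_fset_simps)

lemma size_nested_literal:
  assumes "CL |\<in>| F" "L |\<in>| CL"
  shows "size L < size (Ex R F)" "size L < size (All R F)"
  using size_in_clause_set[OF assms(1)] size_in_clause[OF assms(2)] by simp_all

function literal_ext :: "('c, 'r, 'd) interp \<Rightarrow> ('c, 'r) literal \<Rightarrow> 'd set"
  and clause_ext :: "('c, 'r, 'd) interp \<Rightarrow> ('c, 'r) clause \<Rightarrow> 'd set"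
  and clause_set_ext :: "('c, 'r, 'd) interp \<Rightarrow> ('c, 'r) clause_set \<Rightarrow> 'd set"
where
  "literal_ext I (Pos A) = conc I A"
| "literal_ext I (Neg A) = domain I - conc I A"
| "literal_ext I (Ex R F) =
     {x \<in> domain I. \<exists>y. (x, y) \<in> role I R \<and> y \<in> clause_set_ext I F}"
| "literal_ext I (All R F) =
     {x \<in> domain I. \<forall>y. (x, y) \<in> role I R \<longrightarrow> y \<in> clause_set_ext I F}"
| "clause_ext I CL = {x \<in> domain I. \<exists>L \<in> fset CL. x \<in> literal_ext I L}"
| "clause_set_ext I F = {x \<in> domain I. \<forall>CL \<in> fset F. x \<in> clause_ext I CL}"
  by pat_completeness auto
termination
  by (relation "measure (case_sum (\<lambda>(I, L). size L)
        (case_sum (\<lambda>(I, CL). size_fset size CL) (\<lambda>(I, F). size_fset (size_fset size) F)))")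
     (simp_all add: size_in_clause size_in_clause_set del: size_fset_simps)

declare clause_ext.simps [simp del] clause_set_ext.simps [simp del]

text \<open>The type of the domain elements is a parameter, since HOL cannot quantify over types
  inside a formula.\<close>

definition satisfiable :: "'d itself \<Rightarrow> ('c, 'r) clause_set \<Rightarrow> bool" where
  "satisfiable _ F \<longleftrightarrow> (\<exists>I :: ('c, 'r, 'd) interp. is_interp I \<and> clause_set_ext I F \<noteq> {})"

text \<open>All sets that arise by picking one literal from every clause of \<open>F\<close>.\<close>

definition choices :: "'a fset fset \<Rightarrow> 'a fset fset" where
  "choices F =
     ffilter (\<lambda>T. \<exists>f. (\<forall>CL \<in> fset F. f CL |\<in>| CL) \<and> T = f |`| F) (fPow (ffUnion F))"

lemma choices_iff:
  "T |\<in>| choices F \<longleftrightarrow> (\<exists>f. (\<forall>CL \<in> fset F. f CL |\<in>| CL) \<and> T = f |`| F)"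
proof -
  have "f |`| F |\<subseteq>| ffUnion F" if f: "\<forall>CL \<in> fset F. f CL |\<in>| CL" for f
  proof (rule fsubsetI)
    fix x assume "x |\<in>| f |`| F"
    then obtain CL where "x = f CL" "CL |\<in>| F" by (rule fimageE)
    with f show "x |\<in>| ffUnion F" by (auto simp: ffUnion.rep_eq)
  qed
  then show ?thesis
    unfolding choices_def ffmember_filter fPow_iff by metis
qed

lemma size_in_choices:
  assumes "T |\<in>| choices F" "L |\<in>| T"
  shows "size L < size_fset (size_fset size) F"
proof -
  from assms(1) obtain f where f: "\<forall>CL \<in> fset F. f CL |\<in>| CL" "T = f |`| F"
    unfolding choices_iff by blast
  with assms(2) obtain CL where "CL |\<in>| F" "L = f CL"
    by (metis fimageE)
  with f(1) have "CL |\<in>| F" "L |\<in>| CL"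
    by simp_all
  then show ?thesis
    using less_trans[OF size_in_clause size_in_clause_set] by blast
qed

text \<open>\<open>cnf_neg F\<close> is the conjunctive normal form of the negation of \<open>F\<close>. Pushing the negation
  inward gives the disjunction, over the clauses of \<open>F\<close>, of the conjunctions of the complements of
  their literals. Distributing disjunction over conjunction turns this into one clause of
  complements for each way of picking a literal from every clause of \<open>F\<close>.\<close>

function compl_literal :: "('c, 'r) literal \<Rightarrow> ('c, 'r) literal"
  and cnf_neg :: "('c, 'r) clause_set \<Rightarrow> ('c, 'r) clause_set"
where
  "compl_literal (Pos A) = Neg A"
| "compl_literal (Neg A) = Pos A"
| "compl_literal (Ex R F) = All R (cnf_neg F)"
| "compl_literal (All R F) = Ex R (cnf_neg F)"
| "cnf_neg F = (\<lambda>T. compl_literal |`| T) |`| choices F"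
  by pat_completeness auto
termination
  by (relation "measure (case_sum size (size_fset (size_fset size)))")
     (simp_all add: size_in_choices del: size_fset_simps)

declare cnf_neg.simps [simp del]

lemma cnf_neg_ext_aux:
  assumes "x \<in> domain I"
    and compl: "\<And>CL L. CL |\<in>| F \<Longrightarrow> L |\<in>| CL \<Longrightarrow> literal_ext I (compl_literal L) = domain I - literal_ext I L"
  shows "x \<in> clause_set_ext I (cnf_neg F) \<longleftrightarrow> x \<notin> clause_set_ext I F"
proof
  assume l: "x \<in> clause_set_ext I (cnf_neg F)"
  show "x \<notin> clause_set_ext I F"
  proof
    assume "x \<in> clause_set_ext I F"
    then have "\<forall>CL \<in> fset F. \<exists>L. L |\<in>| CL \<and> x \<in> literal_ext I L"
      by (auto simp: clause_set_ext.simps clause_ext.simps)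
    then obtain f where f: "\<forall>CL \<in> fset F. f CL |\<in>| CL \<and> x \<in> literal_ext I (f CL)"
      by metis
    then have "compl_literal |`| (f |`| F) |\<in>| cnf_neg F"
      unfolding cnf_neg.simps by (intro fimageI) (auto simp: choices_iff)
    with l have "x \<in> clause_ext I (compl_literal |`| (f |`| F))"
      by (auto simp: clause_set_ext.simps)
    with f compl show False
      by (auto simp: clause_ext.simps)
  qed
next
  assume "x \<notin> clause_set_ext I F"
  then obtain CL where "CL |\<in>| F" "\<forall>L \<in> fset CL. x \<notin> literal_ext I L"
    using assms(1) by (auto simp: clause_set_ext.simps clause_ext.simps)
  then have "x \<in> clause_ext I (compl_literal |`| T)" if "T |\<in>| choices F" for T
    using that assms(1) compl unfolding choices_iff
    by (auto simp: clause_ext.simps intro!: bexI[of _ CL])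
  then show "x \<in> clause_set_ext I (cnf_neg F)"
    using assms(1) by (auto simp: clause_set_ext.simps cnf_neg.simps)
qed

lemma compl_ext:
  assumes "is_interp I"
  shows "literal_ext I (compl_literal L) = domain I - literal_ext I L"
proof (induction L rule: measure_induct_rule[of size])
  case (less L)
  have IH: "x \<in> clause_set_ext I (cnf_neg F) \<longleftrightarrow> x \<notin> clause_set_ext I F"
    if "L = Ex R F \<or> L = All R F" "x \<in> domain I" for x R F
  proof (rule cnf_neg_ext_aux[OF that(2)])
    fix CL L'
    assume "CL |\<in>| F" "L' |\<in>| CL"
    then have "size L' < size L"
      using that(1) size_nested_literal by metis
    then show "literal_ext I (compl_literal L') = domain I - literal_ext I L'"
      by (rule less)
  qed
  have dom: "y \<in> domain I" if "(x, y) \<in> role I R" for x y R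
    using that assms by (auto simp: is_interp_def)
  show ?case
  proof (cases L)
    case (Pos A)
    then show ?thesis by simp
  next
    case (Neg A)
    then show ?thesis using assms by (auto simp: is_interp_def)
  next
    case (Ex R F)
    show ?thesis
      unfolding Ex compl_literal.simps literal_ext.simps
      using IH[OF disjI1[OF Ex]] dom by (auto simp del: literal_ext.simps)
  next
    case (All R F)
    show ?thesis
      unfolding All compl_literal.simps literal_ext.simps
      using IH[OF disjI2[OF All]] dom by (auto simp del: literal_ext.simps)
  qed
qed

theorem cnf_neg_ext:
  assumes "is_interp I"
  shows "clause_set_ext I (cnf_neg F) = domain I - clause_set_ext I F"
proof (rule set_eqI)
  fix x
  show "x \<in> clause_set_ext I (cnf_neg F) \<longleftrightarrow> x \<in> domain I - clause_set_ext I F"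
  proof (cases "x \<in> domain I")
    case True
    then show ?thesis
      using cnf_neg_ext_aux[OF True compl_ext[OF assms]] by simp
  next
    case False
    then show ?thesis
      by (simp add: clause_set_ext.simps)
  qed
qed

definition unit_clause :: "('c, 'r) clause \<Rightarrow> bool" where
  "unit_clause CL \<longleftrightarrow> (\<exists>L. CL = {|L|})"

definition A1_result :: "('c, 'r) literal \<Rightarrow> ('c, 'r) clause_set \<Rightarrow> ('c, 'r) clause_set" where
  "A1_result L F = (\<lambda>CL. if L |\<in>| CL then {|L|} else CL |-| {|compl_literal L|}) |`| F"

fun strengthen_Ex :: "'r \<Rightarrow> ('c, 'r) clause_set \<Rightarrow> ('c, 'r) literal \<Rightarrow> ('c, 'r) literal" where
  "strengthen_Ex R F1 (Ex R' F2) = (if R' = R then Ex R (F1 |\<union>| F2) else Ex R' F2)"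
| "strengthen_Ex R F1 L = L"

definition A2_result :: "'r \<Rightarrow> ('c, 'r) clause_set \<Rightarrow> ('c, 'r) clause_set \<Rightarrow> ('c, 'r) clause_set" where
  "A2_result R F1 F =
     (\<lambda>CL. strengthen_Ex R F1 |`| CL) |`| ffilter (\<lambda>CL. All R F1 |\<notin>| CL) F"

text \<open>A rule is applicable only if it changes the clause set. For \<open>A2\<close> and \<open>A3\<close> this is automatic;
  without the side condition \<open>A1_result L F \<noteq> F\<close>, rule \<open>A1\<close> could be applied forever to any
  nonempty clause, for instance to a unit clause \<open>{|L|}\<close>, with no effect.\<close>

inductive rule_step :: "('c, 'r) clause_set set \<Rightarrow> ('c, 'r) clause_set set \<Rightarrow> bool" where
  A1: "rule_step S (S - {F} \<union> {A1_result L F})"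
    if "F \<in> S" "CL |\<in>| F" "L |\<in>| CL" "A1_result L F \<noteq> F"
| A2: "rule_step S (S - {F} \<union> {A2_result R F1 F})"
    if "F \<in> S" "\<forall>CL \<in> fset F. unit_clause CL" "CL |\<in>| F" "All R F1 |\<in>| CL"
| A3: "rule_step S (S - {F} \<union> {F |-| {|{|Ex R F1|}|}, F1})"
    if "F \<in> S"
      "\<forall>CL \<in> fset F. (\<exists>A. CL = {|Pos A|}) \<or> (\<exists>A. CL = {|Neg A|}) \<or> (\<exists>R' F'. CL = {|Ex R' F'|})"
      "{|Ex R F1|} |\<in>| F"

definition family_complete :: "('c, 'r) clause_set set \<Rightarrow> bool" where
  "family_complete S \<longleftrightarrow> (\<nexists>S'. rule_step S S')"

definition family_clash_free :: "('c, 'r) clause_set set \<Rightarrow> bool" where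
  "family_clash_free S \<longleftrightarrow>
     (\<forall>F \<in> S. {||} |\<notin>| F \<and> (\<nexists>L. {|L|} |\<in>| F \<and> {|compl_literal L|} |\<in>| F))"

end

theory Submission
  imports Defs "HOL-Library.Multiset"
begin

text \<open>Fix an interpretation satisfying the initial clause set. If the \<open>A1\<close> choice always picks a
  literal that is true at a witness, every rule keeps each member of the family satisfied somewhere
  in this interpretation, so no clash arises. Each rule replaces a clause set by clause sets that
  are smaller in the lexicographic order of role depth and total number of literal occurrences, so
  the multiset extension of this order shows that the derivation ends. Role depth has to be a
  maximum, not a sum, because \<open>A2\<close> copies \<open>F1\<close> into every matching existential literal.\<close>

section \<open>Role depth and the termination order\<close>

primrec literal_depth :: "('c, 'r) literal \<Rightarrow> nat" where
  "literal_depth (Pos A) = 0"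
| "literal_depth (Neg A) = 0"
| "literal_depth (Ex R F) = Suc (Sup (fset (ffUnion (fimage (fimage literal_depth) F))))"
| "literal_depth (All R F) = Suc (Sup (fset (ffUnion (fimage (fimage literal_depth) F))))"

text \<open>\<open>Sup\<close> on natural numbers is 0 at the empty set, so a clause set without
  literals has depth 0.\<close>

definition clause_set_depth :: "('c, 'r) clause_set \<Rightarrow> nat" where
  "clause_set_depth F = Sup (fset (ffUnion (fimage (fimage literal_depth) F)))"

lemma literal_depth_quantified [simp]:
  "literal_depth (Ex R F) = Suc (clause_set_depth F)"
  "literal_depth (All R F) = Suc (clause_set_depth F)"
  by (simp_all add: clause_set_depth_def)

declare literal_depth.simps(3,4) [simp del]

lemma clause_set_depth_le_iff:
  "clause_set_depth F \<le> n \<longleftrightarrow> (\<forall>CL \<in> fset F. \<forall>L \<in> fset CL. literal_depth L \<le> n)"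
proof -
  let ?X = "fset (ffUnion (fimage (fimage literal_depth) F))"
  have "Sup ?X \<le> n \<longleftrightarrow> (\<forall>k \<in> ?X. k \<le> n)"
    by (cases "?X = {}") (simp_all add: Sup_nat_def)
  also have "\<dots> \<longleftrightarrow> (\<forall>CL \<in> fset F. \<forall>L \<in> fset CL. literal_depth L \<le> n)"
    by (simp add: ffUnion.rep_eq)
  finally show ?thesis
    by (simp add: clause_set_depth_def)
qed

lemma literal_depth_le_clause_set_depth:
  "CL |\<in>| F \<Longrightarrow> L |\<in>| CL \<Longrightarrow> literal_depth L \<le> clause_set_depth F"
  using clause_set_depth_le_iff[of F "clause_set_depth F"] by simp

lemma clause_set_depth_union_le:
  "clause_set_depth (F |\<union>| G) \<le> max (clause_set_depth F) (clause_set_depth G)"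
  unfolding clause_set_depth_le_iff[of "F |\<union>| G"]
  by (auto dest!: literal_depth_le_clause_set_depth)

text \<open>Only top-level literals count, so enlarging a clause set below an existential
  quantifier, as A2 does, adds nothing.\<close>

definition occurrences :: "('c, 'r) clause_set \<Rightarrow> nat" where
  "occurrences F = (\<Sum>CL \<in> fset F. fcard CL)"

definition clause_set_order :: "(('c, 'r) clause_set \<times> ('c, 'r) clause_set) set" where
  "clause_set_order = measures [clause_set_depth, occurrences]"

lemma clause_set_orderI:
  "clause_set_depth G \<le> clause_set_depth F \<Longrightarrow> occurrences G < occurrences F \<Longrightarrow>
    (G, F) \<in> clause_set_order"
  by (auto simp: clause_set_order_def)

section \<open>Decrease of the order under each rule\<close>

lemma occurrences_fimage_le: "occurrences (f |`| F) \<le> (\<Sum>CL \<in> fset F. fcard (f CL))"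
  unfolding occurrences_def using sum_image_le[of "fset F" fcard f] by simp

lemma fcard_fimage_le: "fcard (f |`| A) \<le> fcard A"
  by (simp add: fcard.rep_eq card_image_le)

lemma occurrences_fminus_less:
  assumes "CL |\<in>| F" "CL \<noteq> {||}"
  shows "occurrences (F |-| {|CL|}) < occurrences F"
proof -
  have "occurrences F = fcard CL + occurrences (F |-| {|CL|})"
    unfolding occurrences_def using sum.remove[of "fset F" CL fcard] assms(1) by simp
  then show ?thesis
    using assms(2) by (auto simp: fcard.rep_eq card_gt_0_iff)
qed

lemma occurrences_mono: "F |\<subseteq>| G \<Longrightarrow> occurrences F \<le> occurrences G"
  unfolding occurrences_def by (rule sum_mono2) (auto simp: less_eq_fset.rep_eq)

text \<open>The chosen clause has at least two literals and shrinks to one, while no other clause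
  grows. Literals are only kept or deleted, so the depth cannot rise.\<close>

lemma A1_result_less:
  assumes "CL |\<in>| F" "L |\<in>| CL" "\<not> unit_clause CL"
  shows "(A1_result L F, F) \<in> clause_set_order"
proof (rule clause_set_orderI)
  show "clause_set_depth (A1_result L F) \<le> clause_set_depth F"
    unfolding clause_set_depth_le_iff A1_result_def
    by (auto intro: literal_depth_le_clause_set_depth)
next
  let ?f = "\<lambda>CL. if L |\<in>| CL then {|L|} else CL |-| {|compl_literal L|}"
  have le: "fcard (?f C) \<le> fcard C" for C
  proof (cases "L |\<in>| C")
    case True
    then have "{|L|} |\<subseteq>| C" by simp
    then have "fcard {|L|} \<le> fcard C" by (rule fcard_mono)
    with True show ?thesis by simp
  next
    case False
    then show ?thesis by (auto intro: fcard_mono)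
  qed
  have "{|L|} |\<subset>| CL"
    using assms(2,3) by (auto simp: unit_clause_def)
  then have "fcard {|L|} < fcard CL" by (rule pfsubset_fcard_mono)
  then have "fcard (?f CL) < fcard CL" using assms(2) by simp
  then have "(\<Sum>C \<in> fset F. fcard (?f C)) < (\<Sum>C \<in> fset F. fcard C)"
    using assms(1) le by (intro sum_strict_mono_ex1 finite_fset bexI[of _ CL] ballI)
  then show "occurrences (A1_result L F) < occurrences F"
    using occurrences_fimage_le[of ?f F] by (simp add: A1_result_def occurrences_def)
qed

text \<open>Provides the side condition of \<open>A1\<close>.\<close>

lemma A1_result_neq:
  assumes "CL |\<in>| F" "L |\<in>| CL" "\<not> unit_clause CL"
  shows "A1_result L F \<noteq> F"
  using A1_result_less[OF assms] by (auto simp: clause_set_order_def)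

text \<open>\<open>All R F1\<close> and each \<open>Ex R F2\<close> to be enlarged occur in clauses
  of \<open>F\<close>, so \<open>F1\<close>, \<open>F2\<close> and hence their union have depth
  below that of \<open>F\<close>. Occurrences drop because the nonempty clause \<open>CL\<close> is
  removed.\<close>

lemma A2_result_less:
  assumes "CL |\<in>| F" "All R F1 |\<in>| CL"
  shows "(A2_result R F1 F, F) \<in> clause_set_order"
proof (rule clause_set_orderI)
  have "literal_depth (strengthen_Ex R F1 L) \<le> clause_set_depth F"
    if "C |\<in>| F" "L |\<in>| C" for C L
    using literal_depth_le_clause_set_depth[OF assms] literal_depth_le_clause_set_depth[OF that]
    by (cases "(R, F1, L)" rule: strengthen_Ex.cases)
      (auto simp: Suc_le_eq intro: le_less_trans[OF clause_set_depth_union_le])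
  then show "clause_set_depth (A2_result R F1 F) \<le> clause_set_depth F"
    unfolding clause_set_depth_le_iff A2_result_def by auto
next
  let ?G = "ffilter (\<lambda>CL. All R F1 |\<notin>| CL) F"
  have "occurrences (A2_result R F1 F) \<le> (\<Sum>C \<in> fset ?G. fcard (strengthen_Ex R F1 |`| C))"
    unfolding A2_result_def by (rule occurrences_fimage_le)
  also have "\<dots> \<le> occurrences ?G"
    unfolding occurrences_def by (intro sum_mono fcard_fimage_le)
  also have "\<dots> \<le> occurrences (F |-| {|CL|})"
    using assms(2) by (intro occurrences_mono) auto
  also have "\<dots> < occurrences F"
    using assms by (intro occurrences_fminus_less) auto
  finally show "occurrences (A2_result R F1 F) < occurrences F" .
qed

text \<open>\<open>F1\<close> may have more occurrences than \<open>F\<close>, but it has lost a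
  quantifier; this is why depth is compared first.\<close>

lemma A3_results_less:
  assumes "{|Ex R F1|} |\<in>| F"
  shows "(F |-| {|{|Ex R F1|}|}, F) \<in> clause_set_order" "(F1, F) \<in> clause_set_order"
proof -
  show "(F |-| {|{|Ex R F1|}|}, F) \<in> clause_set_order"
  proof (rule clause_set_orderI)
    show "clause_set_depth (F |-| {|{|Ex R F1|}|}) \<le> clause_set_depth F"
      unfolding clause_set_depth_le_iff by (auto intro: literal_depth_le_clause_set_depth)
  qed (use assms in \<open>simp add: occurrences_fminus_less\<close>)
  show "(F1, F) \<in> clause_set_order"
    using literal_depth_le_clause_set_depth[OF assms, of "Ex R F1"]
    by (simp add: clause_set_order_def)
qed

section \<open>Preservation of truth at a point of the interpretation\<close>

lemma in_clause_set_ext_iff: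
  "x \<in> clause_set_ext I F \<longleftrightarrow>
    x \<in> domain I \<and> (\<forall>CL \<in> fset F. \<exists>L \<in> fset CL. x \<in> literal_ext I L)"
  by (auto simp: clause_set_ext.simps clause_ext.simps)

lemma in_clause_set_ext_unit:
  "x \<in> clause_set_ext I F \<Longrightarrow> {|L|} |\<in>| F \<Longrightarrow> x \<in> literal_ext I L"
  by (auto simp: in_clause_set_ext_iff)

text \<open>\<open>compl_literal L\<close> is false at \<open>x\<close>, so a clause that loses it
  keeps its true literal.\<close>

lemma A1_result_ext:
  assumes "is_interp I" "x \<in> clause_set_ext I F" "x \<in> literal_ext I L"
  shows "x \<in> clause_set_ext I (A1_result L F)"
proof -
  have "x \<notin> literal_ext I (compl_literal L)"
    using compl_ext[OF assms(1)] assms(3) by blast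
  with assms(2,3) show ?thesis
    by (fastforce simp: in_clause_set_ext_iff A1_result_def)
qed

text \<open>The successor that witnesses \<open>Ex R F2\<close> lies in \<open>F1\<close> by the
  universal literal, so it also witnesses the enlarged one.\<close>

lemma strengthen_Ex_ext:
  assumes "x \<in> literal_ext I (All R F1)" "x \<in> literal_ext I L"
  shows "x \<in> literal_ext I (strengthen_Ex R F1 L)"
  using assms
  by (cases "(R, F1, L)" rule: strengthen_Ex.cases) (auto simp: clause_set_ext.simps)

lemma A2_result_ext:
  assumes "x \<in> clause_set_ext I F" "x \<in> literal_ext I (All R F1)"
  shows "x \<in> clause_set_ext I (A2_result R F1 F)"
  using assms(1) strengthen_Ex_ext[OF assms(2)]
  by (fastforce simp: in_clause_set_ext_iff A2_result_def simp del: literal_ext.simps)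

text \<open>Guarantees a non-unit clause whenever \<open>A1\<close> applies. As \<open>{|L|}\<close>
  is a clause of \<open>F\<close> true at \<open>x\<close>, the unit clause of the complement cannot
  occur, and nothing is left to change.\<close>

lemma A1_result_unit_clauses:
  assumes I: "is_interp I" and x: "x \<in> clause_set_ext I F"
    and unit: "\<forall>CL \<in> fset F. unit_clause CL" and CL: "CL |\<in>| F" "L |\<in>| CL"
  shows "A1_result L F = F"
proof -
  have "{|L|} |\<in>| F"
    using unit CL by (auto simp: unit_clause_def)
  then have "x \<in> literal_ext I L"
    by (rule in_clause_set_ext_unit[OF x])
  then have "x \<notin> literal_ext I (compl_literal L)"
    using compl_ext[OF I] by blast
  then have "{|compl_literal L|} |\<notin>| F"
    using in_clause_set_ext_unit[OF x] by blast
  then have "(if L |\<in>| C then {|L|} else C |-| {|compl_literal L|}) = C" if "C |\<in>| F" for C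
    using that unit by (force simp: unit_clause_def)
  then have "A1_result L F = id |`| F"
    unfolding A1_result_def by (intro fset.map_cong0) simp
  then show ?thesis by simp
qed

text \<open>The given step only shows that some rule applies. An \<open>A1\<close> step may have
  chosen a false literal, so it is traded for a suitable one on the same clause set; A2 and A3 steps
  are kept. The set \<open>N\<close> covers one or two replacements alike.\<close>

lemma satisfying_step_exists:
  assumes I: "is_interp I" and sat: "\<forall>F \<in> S. clause_set_ext I F \<noteq> {}" and step: "rule_step S S'"
  shows "\<exists>F \<in> S. \<exists>N. finite N \<and> rule_step S (S - {F} \<union> N) \<and>
    (\<forall>G \<in> N. clause_set_ext I G \<noteq> {} \<and> (G, F) \<in> clause_set_order)"
  using step
proof cases
  case (A1 F CL L)
  from A1 sat obtain x where x: "x \<in> clause_set_ext I F" by blast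
  \<comment> \<open>If all clauses were unit, the given step would leave \<open>F\<close>
    unchanged.\<close>
  obtain C where C: "C |\<in>| F" "\<not> unit_clause C"
    using A1_result_unit_clauses[OF I x] A1 by metis
  from x C(1) obtain K where K: "K |\<in>| C" "x \<in> literal_ext I K"
    by (auto simp: in_clause_set_ext_iff)
  have "rule_step S (S - {F} \<union> {A1_result K F})"
    using rule_step.A1 A1(2) C K(1) A1_result_neq by metis
  moreover have "clause_set_ext I (A1_result K F) \<noteq> {}"
    using A1_result_ext[OF I x K(2)] by blast
  ultimately show ?thesis
    using A1_result_less[OF C(1) K(1) C(2)] A1(2)
    by (intro bexI[of _ F] exI[of _ "{A1_result K F}"]) auto
next
  case (A2 F CL R F1)
  from A2 sat obtain x where x: "x \<in> clause_set_ext I F" by blast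
  \<comment> \<open>The unit premise of A2 makes the universal literal a clause by itself, hence
    true at \<open>x\<close>.\<close>
  have "{|All R F1|} |\<in>| F"
    using A2 by (auto simp: unit_clause_def)
  then have "x \<in> clause_set_ext I (A2_result R F1 F)"
    by (intro A2_result_ext x in_clause_set_ext_unit[OF x])
  then have "clause_set_ext I (A2_result R F1 F) \<noteq> {}" by blast
  with A2 step show ?thesis
    using A2_result_less[of CL F R F1]
    by (intro bexI[of _ F] exI[of _ "{A2_result R F1 F}"]) auto
next
  case (A3 F R F1)
  from A3 sat obtain x where x: "x \<in> clause_set_ext I F" by blast
  have "x \<in> clause_set_ext I (F |-| {|{|Ex R F1|}|})"
    using x by (auto simp: in_clause_set_ext_iff)
  \<comment> \<open>The witness for \<open>F1\<close> is a successor of \<open>x\<close>, so the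
    members of a family need not share a satisfying point.\<close>
  moreover have "clause_set_ext I F1 \<noteq> {}"
    using in_clause_set_ext_unit[OF x A3(4)] by auto
  ultimately show ?thesis
    using A3_results_less[OF A3(4)] A3 step
    by (intro bexI[of _ F] exI[of _ "{F |-| {|{|Ex R F1|}|}, F1}"]) auto
qed

section \<open>Termination by multisets and freedom from clashes\<close>

lemma mset_set_replace_mult:
  assumes "finite S" "a \<in> S" "finite N" "\<forall>b \<in> N. (b, a) \<in> r"
  shows "(mset_set (S - {a} \<union> N), mset_set S) \<in> mult r"
proof -
  \<comment> \<open>Elements of \<open>N\<close> already in \<open>S - {a}\<close> add nothing to
    the set, so only the others enter the multiset.\<close>
  have "S - {a} \<union> N = (S - {a}) \<union> (N - (S - {a}))" by blast
  then have "mset_set (S - {a} \<union> N) = mset_set (S - {a}) + mset_set (N - (S - {a}))"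
    using assms(1,3) by (metis Diff_disjoint finite_Diff mset_set_Union)
  moreover have "mset_set S = mset_set (S - {a}) + {#a#}"
    using assms(1,2) by (simp add: mset_set.remove)
  moreover have "(mset_set (S - {a}) + mset_set (N - (S - {a})), mset_set (S - {a}) + {#a#}) \<in> mult r"
    using assms(3,4) by (intro one_step_implies_mult) auto
  ultimately show ?thesis by simp
qed

text \<open>An empty clause has no true literal, and complementary literals have disjoint
  extensions.\<close>

lemma clash_free_if_satisfied:
  assumes I: "is_interp I" and sat: "\<forall>F \<in> S. clause_set_ext I F \<noteq> {}"
  shows "family_clash_free S"
  unfolding family_clash_free_def
proof (intro ballI conjI notI)
  fix F assume "F \<in> S"
  with sat obtain x where x: "x \<in> clause_set_ext I F" by blast
  show False if "{||} |\<in>| F"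
    using x that by (auto simp: in_clause_set_ext_iff)
  show False if "\<exists>L. {|L|} |\<in>| F \<and> {|compl_literal L|} |\<in>| F"
    using that in_clause_set_ext_unit[OF x] compl_ext[OF I] by blast
qed

text \<open>Finiteness belongs to the invariant since \<open>mset_set\<close> maps infinite sets to
  the empty multiset, which would hide the decrease.\<close>

lemma complete_family_reachable:
  assumes I: "is_interp I"
    and "finite S" "\<forall>F \<in> S. clause_set_ext I F \<noteq> {}"
  shows "\<exists>S'. rule_step\<^sup>*\<^sup>* S S' \<and> family_complete S' \<and> (\<forall>F \<in> S'. clause_set_ext I F \<noteq> {})"
proof -
  have "wf (inv_image (mult clause_set_order) mset_set)"
    unfolding clause_set_order_def by (intro wf_inv_image wf_mult wf_measures)
  then show ?thesis
    using assms(2,3)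
  proof (induction S rule: wf_induct_rule)
    case (less S)
    show ?case
    proof (cases "family_complete S")
      case True
      with less.prems show ?thesis by blast
    next
      case False
      then obtain S' where "rule_step S S'"
        by (auto simp: family_complete_def)
      from satisfying_step_exists[OF I less.prems(2) this]
      obtain F N where FN: "F \<in> S" "finite N" "rule_step S (S - {F} \<union> N)"
        "\<forall>G \<in> N. clause_set_ext I G \<noteq> {} \<and> (G, F) \<in> clause_set_order"
        by blast
      have "(S - {F} \<union> N, S) \<in> inv_image (mult clause_set_order) mset_set"
        using mset_set_replace_mult[OF less.prems(1) FN(1,2)] FN(4) by simp
      from less.IH[OF this] obtain S'' where "rule_step\<^sup>*\<^sup>* (S - {F} \<union> N) S''"
        "family_complete S''" "\<forall>F \<in> S''. clause_set_ext I F \<noteq> {}"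
        using less.prems FN(2,4) by blast
      with FN(3) show ?thesis
        by (meson converse_rtranclp_into_rtranclp)
    qed
  qed
qed

theorem mainTheorem7:
  fixes F :: "('c, 'r) clause_set"
  assumes "satisfiable TYPE('d) F"
  shows "\<exists>S. rule_step\<^sup>*\<^sup>* {F} S \<and> family_complete S \<and> family_clash_free S"
proof -
  from assms obtain I :: "('c, 'r, 'd) interp"
    where I: "is_interp I" and "clause_set_ext I F \<noteq> {}"
    unfolding satisfiable_def by blast
  then show ?thesis
    using complete_family_reachable[OF I, of "{F}"] clash_free_if_satisfied[OF I] by auto
qed

end
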